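(* Let $(X_n)_{n\ge0}$ be Markov chains on $(\mathbb S_n)_{n\ge0}$ with transition matrices $p_n$, rates $(c_n)$ and down-operators $(D_n)$ satisfying (A0)--(A5) of the context, let $E,\iota,(d^o_s)_{s\in\mathbb S}$ satisfy (L1)--(L3) of the context, and suppose $c_n\to\infty$. Let $F$ be the limiting Feller process of the chains (see context), and let $\rho$ be the metric of $E$. Suppose that $$\sup_{r,s\in\mathbb S_n,\ p_n(r,s)>0}\rho(\iota(r),\iota(s))\xrightarrow[n\to\infty]{}0.$$ Then $F$ is almost surely continuous.
   Context: $C(Z)$: continuous real functions on $Z$ with the sup norm (all functions if $Z$ finite). A transition operator from $C(Z')$ to $C(Z)$ ($Z,Z'$ finite) is a map $f\mapsto\sum_{y\in Z'}\mu(\cdot,y)f(y)$ with $\mu$ a stochastic $Z\times Z'$ matrix. $\mathbb S=\bigcup_n\mathbb S_n$; $|s|$ is the $n$ with $s\in\mathbb S_n$; $\mathbf 1_u$ is the indicator of $\{u\}$; $(f)_n=f|_{\mathbb S_n}$. (A0) $\mathbb S_0,\mathbb S_1,\dots$ are finite and pairwise disjoint and $\mathbb S_0=\{\varnothing\}$. $T_n$ is the transition operator of the Markov chain $X_n$ on $\mathbb S_n$, $A_n=c_n(T_n-I)$, $(D_n)_{n\ge1}$ are linear operators, and for all $n\ge0$: (A1) $0<c_n<c_{n+1}$; (A2) $D_{n+1}$ is a transition operator from $C(\mathbb S_n)$ to $C(\mathbb S_{n+1})$; (A3) $\operatorname{range}(A_{n+1}+c_nI)\subset\operatorname{range}D_{n+1}$;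 (A4) $D_{n+1}$ is injective; (A5) $A_{n+1}D_{n+1}=D_{n+1}A_n$. $d_s(u)=(D_{|u|}\cdots D_{|s|+1}\mathbf 1_s)(u)$ if $|u|\ge|s|$ ($=\mathbf 1_s(u)$ if $|u|=|s|$), else $0$. $E$ is a compact metric space, $\iota:\mathbb S\to E$ a map, $d^o_s\in C(E)$, and: (L1) for every $x\in E$ there are $s_n\in\mathbb S_n$ with $\iota(s_n)\to x$; (L2) $\operatorname{span}\{d^o_s\}$ is dense in $C(E)$; (L3) $\|(d_s)_n-d^o_s\circ\iota|_{\mathbb S_n}\|_{C(\mathbb S_n)}\to0$ for each $s$. Limiting process: it is known that, when $c_n\to\infty$, $(\varepsilon_n)$ is a positive sequence with $\varepsilon_nc_n\to1$, and the laws of $\iota(X_n(0))$ converge weakly to $\mu$, there is a Feller process $F$ in $E$ with initial distribution $\mu$ and sample paths in the Skorokhod space $D([0,\infty),E)$ such that $(\iota(X_n(\lfloor t/\varepsilon_n\rfloor)))_{t\ge0}\Rightarrow(F(t))_{t\ge0}$ in distribution in $D([0,\infty),E)$. This is the process $F$ of the claim. *)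

theory Defs
  imports "HOL-Probability.Probability"
begin

section \<open>Operators between finite state spaces\<close>

text \<open>For a finite set Z, the space C(Z) is encoded as the set of real functions on the ambient
  type that vanish off Z; this makes it a vector space under the pointwise operations.\<close>

definition CZ :: "'s set \<Rightarrow> ('s \<Rightarrow> real) set" where
  "CZ Z = {f. \<forall>x. x \<notin> Z \<longrightarrow> f x = 0}"

definition stochastic_matrix :: "'s set \<Rightarrow> 's set \<Rightarrow> ('s \<Rightarrow> 's \<Rightarrow> real) \<Rightarrow> bool" where
  "stochastic_matrix Z Z' m \<longleftrightarrow>
     (\<forall>x\<in>Z. (\<forall>y\<in>Z'. 0 \<le> m x y) \<and> (\<Sum>y\<in>Z'. m x y) = 1)"

definition matrix_op :: "'s set \<Rightarrow> 's set \<Rightarrow> ('s \<Rightarrow> 's \<Rightarrow> real) \<Rightarrow> ('s \<Rightarrow> real) \<Rightarrow> ('s \<Rightarrow> real)" where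
  "matrix_op Z Z' m f = (\<lambda>x. if x \<in> Z then \<Sum>y\<in>Z'. m x y * f y else 0)"

text \<open>\<open>L\<close> is a transition operator from C(Z') to C(Z).  Nothing is said about \<open>L f\<close> for
  \<open>f\<close> outside C(Z').\<close>

definition transition_operator ::
    "'s set \<Rightarrow> 's set \<Rightarrow> (('s \<Rightarrow> real) \<Rightarrow> ('s \<Rightarrow> real)) \<Rightarrow> bool" where
  "transition_operator Z' Z L \<longleftrightarrow>
     (\<exists>m. stochastic_matrix Z Z' m \<and> (\<forall>f\<in>CZ Z'. L f = matrix_op Z Z' m f))"

text \<open>The operator \<open>A\<^sub>n = c\<^sub>n (T\<^sub>n - I)\<close>.\<close>

definition gen_A ::
    "(nat \<Rightarrow> 's set) \<Rightarrow> (nat \<Rightarrow> 's \<Rightarrow> 's \<Rightarrow> real) \<Rightarrow> (nat \<Rightarrow> real) \<Rightarrow> nat \<Rightarrow>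
     ('s \<Rightarrow> real) \<Rightarrow> ('s \<Rightarrow> real)" where
  "gen_A S p c n f = (\<lambda>x. c n * (matrix_op (S n) (S n) (p n) f x - f x))"

definition level :: "(nat \<Rightarrow> 's set) \<Rightarrow> 's \<Rightarrow> nat" where
  "level S s = (THE n. s \<in> S n)"

text \<open>\<open>down_comp D m k\<close> is the composition \<open>D\<^sub>m\<^sub>+\<^sub>k \<circ> \<dots> \<circ> D\<^sub>m\<^sub>+\<^sub>1\<close>.\<close>

primrec down_comp ::
    "(nat \<Rightarrow> ('s \<Rightarrow> real) \<Rightarrow> ('s \<Rightarrow> real)) \<Rightarrow> nat \<Rightarrow> nat \<Rightarrow> ('s \<Rightarrow> real) \<Rightarrow> ('s \<Rightarrow> real)" where
  "down_comp D m 0 f = f"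
| "down_comp D m (Suc k) f = D (Suc (m + k)) (down_comp D m k f)"

definition dens ::
    "(nat \<Rightarrow> 's set) \<Rightarrow> (nat \<Rightarrow> ('s \<Rightarrow> real) \<Rightarrow> ('s \<Rightarrow> real)) \<Rightarrow> 's \<Rightarrow> 's \<Rightarrow> real" where
  "dens S D s u =
     (if level S s \<le> level S u
      then down_comp D (level S s) (level S u - level S s) (indicator {s}) u else 0)"

section \<open>Markov chains\<close>

definition markov_chain ::
    "'w measure \<Rightarrow> 's set \<Rightarrow> ('s \<Rightarrow> 's \<Rightarrow> real) \<Rightarrow> (nat \<Rightarrow> 'w \<Rightarrow> 's) \<Rightarrow> bool" where
  "markov_chain M Z q X \<longleftrightarrow>
     prob_space M \<and> stochastic_matrix Z Z q \<and>
     (\<forall>k. X k \<in> measurable M (count_space Z)) \<and>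
     (\<forall>k x. \<forall>y\<in>Z.
        \<P>(\<omega> in M. \<forall>i\<le>k. X i \<omega> = x i) > 0 \<longrightarrow>
        \<P>(\<omega> in M. X (Suc k) \<omega> = y \<bar> \<forall>i\<le>k. X i \<omega> = x i) = q (x k) y)"

section \<open>Weak convergence\<close>

definition borel_of :: "'a topology \<Rightarrow> 'a measure" where
  "borel_of T = sigma (topspace T) {U. openin T U}"

lemma borel_of_euclidean: "borel_of euclidean = borel"
  by (simp add: borel_of_def borel_def)

definition weakly_converges :: "'a topology \<Rightarrow> (nat \<Rightarrow> 'a measure) \<Rightarrow> 'a measure \<Rightarrow> bool" where
  "weakly_converges T Ps P \<longleftrightarrow>
     (\<forall>n. prob_space (Ps n) \<and> sets (Ps n) = sets (borel_of T)) \<and>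
     prob_space P \<and> sets P = sets (borel_of T) \<and>
     (\<forall>f :: 'a \<Rightarrow> real. continuous_map T euclideanreal f \<and> bounded (f ` topspace T) \<longrightarrow>
        (\<lambda>n. LINT x|Ps n. f x) \<longlonglongrightarrow> (LINT x|P. f x))"

definition converges_in_distribution ::
    "'a topology \<Rightarrow> (nat \<Rightarrow> 'w measure) \<Rightarrow> (nat \<Rightarrow> 'w \<Rightarrow> 'a) \<Rightarrow> 'v measure \<Rightarrow> ('v \<Rightarrow> 'a) \<Rightarrow> bool"
  where
  "converges_in_distribution T M Y N Z \<longleftrightarrow>
     (\<forall>n. Y n \<in> measurable (M n) (borel_of T)) \<and> Z \<in> measurable N (borel_of T) \<and>
     weakly_converges T (\<lambda>n. distr (M n) (borel_of T) (Y n)) (distr N (borel_of T) Z)"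

section \<open>The Skorokhod space on the half-line\<close>

text \<open>A function on \<open>[0, \<infinity>)\<close> is encoded as an element of \<open>extensional {0..}\<close>.\<close>

definition cadlag :: "(real \<Rightarrow> 'e::topological_space) \<Rightarrow> bool" where
  "cadlag x \<longleftrightarrow> (\<forall>t\<ge>0. (x \<longlongrightarrow> x t) (at_right t)) \<and> (\<forall>t>0. \<exists>l. (x \<longlongrightarrow> l) (at_left t))"

definition skorokhod_space :: "(real \<Rightarrow> 'e::topological_space) set" where
  "skorokhod_space = {x \<in> extensional {0..}. cadlag x}"

text \<open>The metric is the one of Ethier and Kurtz (Markov Processes: Characterization and
  Convergence, Section 3.5):
  the infimum over the time changes \<open>l\<close> of the maximum of
  \<open>\<gamma>(l) = sup {|log ((l s - l t) / (s - t))| : 0 \<le> t < s}\<close> and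
  \<open>\<integral>\<^sub>0\<^sup>\<infinity> e\<^sup>-\<^sup>u sup {min 1 (dist (x (t \<and> u)) (y (l t \<and> u))) : t \<ge> 0} du\<close>.
  It is at most 1; it is given the type ennreal because \<open>\<gamma>(l)\<close> is defined through
  a supremum that may be infinite.  Finiteness of \<open>\<gamma>(l)\<close> makes \<open>l\<close> Lipschitz.\<close>

definition time_gamma :: "(real \<Rightarrow> real) \<Rightarrow> ennreal" where
  "time_gamma l = (SUP (s, t) \<in> {(s, t). 0 \<le> t \<and> t < s}. ennreal \<bar>ln ((l s - l t) / (s - t))\<bar>)"

definition time_changes :: "(real \<Rightarrow> real) set" where
  "time_changes = {l. strict_mono_on {0..} l \<and> l ` {0..} = {0..} \<and> time_gamma l < \<infinity>}"

definition stopped_dist ::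
    "(real \<Rightarrow> 'e::metric_space) \<Rightarrow> (real \<Rightarrow> 'e) \<Rightarrow> (real \<Rightarrow> real) \<Rightarrow> real \<Rightarrow> real" where
  "stopped_dist x y l u = (SUP t\<in>{0..}. min 1 (dist (x (min t u)) (y (min (l t) u))))"

definition skorokhod_dist ::
    "(real \<Rightarrow> 'e::metric_space) \<Rightarrow> (real \<Rightarrow> 'e) \<Rightarrow> ennreal" where
  "skorokhod_dist x y =
     (INF l\<in>time_changes.
        max (time_gamma l) (\<integral>\<^sup>+u\<in>{0..}. ennreal (exp (- u) * stopped_dist x y l u) \<partial>lborel))"

definition skorokhod_topology :: "(real \<Rightarrow> 'e::metric_space) topology" where
  "skorokhod_topology = topology (\<lambda>U. U \<subseteq> skorokhod_space \<and>
     (\<forall>x\<in>U. \<exists>r>0. \<forall>y\<in>skorokhod_space. skorokhod_dist x y < r \<longrightarrow> y \<in> U))"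

lemma openin_skorokhod_topology:
  "openin skorokhod_topology U \<longleftrightarrow> U \<subseteq> skorokhod_space \<and>
     (\<forall>x\<in>U. \<exists>r>0. \<forall>y\<in>skorokhod_space. skorokhod_dist x y < r \<longrightarrow> y \<in> U)"
proof -
  let ?P = "\<lambda>U :: (real \<Rightarrow> 'a) set. U \<subseteq> skorokhod_space \<and>
     (\<forall>x\<in>U. \<exists>r>0. \<forall>y\<in>skorokhod_space. skorokhod_dist x y < r \<longrightarrow> y \<in> U)"
  have "istopology ?P"
    unfolding istopology_def
  proof (intro conjI allI impI)
    fix A B assume AB: "?P A" "?P B"
    then show "A \<inter> B \<subseteq> skorokhod_space" by blast
    show "\<forall>x\<in>A \<inter> B. \<exists>r>0. \<forall>y\<in>skorokhod_space. skorokhod_dist x y < r \<longrightarrow> y \<in> A \<inter> B"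
    proof
      fix x assume "x \<in> A \<inter> B"
      then obtain r1 r2 where
        "r1 > 0" "\<forall>y\<in>skorokhod_space. skorokhod_dist x y < r1 \<longrightarrow> y \<in> A"
        "r2 > 0" "\<forall>y\<in>skorokhod_space. skorokhod_dist x y < r2 \<longrightarrow> y \<in> B"
        using AB by blast
      then show "\<exists>r>0. \<forall>y\<in>skorokhod_space. skorokhod_dist x y < r \<longrightarrow> y \<in> A \<inter> B"
        by (intro exI[of _ "min r1 r2"]) auto
    qed
  next
    fix K assume K: "\<forall>A\<in>K. ?P A"
    then show "\<Union>K \<subseteq> skorokhod_space" by blast
    show "\<forall>x\<in>\<Union>K. \<exists>r>0. \<forall>y\<in>skorokhod_space. skorokhod_dist x y < r \<longrightarrow> y \<in> \<Union>K"
    proof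
      fix x assume "x \<in> \<Union>K"
      then obtain A where "A \<in> K" "x \<in> A" by blast
      then obtain r where "r > 0" "\<forall>y\<in>skorokhod_space. skorokhod_dist x y < r \<longrightarrow> y \<in> A"
        using K by blast
      then show "\<exists>r>0. \<forall>y\<in>skorokhod_space. skorokhod_dist x y < r \<longrightarrow> y \<in> \<Union>K"
        using \<open>A \<in> K\<close> by blast
    qed
  qed
  then show ?thesis
    unfolding skorokhod_topology_def by (simp add: topology_inverse')
qed

lemma topspace_skorokhod_topology: "topspace skorokhod_topology = skorokhod_space"
proof -
  have "openin skorokhod_topology (skorokhod_space :: (real \<Rightarrow> 'a) set)"
    unfolding openin_skorokhod_topology by (auto intro: exI[of _ 1])
  then show ?thesis
    by (meson openin_skorokhod_topology openin_subset openin_topspace subset_antisym)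
qed

definition sample_path :: "(real \<Rightarrow> 'v \<Rightarrow> 'e) \<Rightarrow> 'v \<Rightarrow> real \<Rightarrow> 'e" where
  "sample_path F \<omega> = (\<lambda>t\<in>{0..}. F t \<omega>)"

section \<open>Feller processes in a compact metric space\<close>

text \<open>The state space is the whole type, assumed compact where the notion is used, so that
  C(E) is the type of bounded continuous functions with its supremum norm.\<close>

definition feller_semigroup ::
    "(real \<Rightarrow> ('e::metric_space \<Rightarrow>\<^sub>C real) \<Rightarrow> ('e \<Rightarrow>\<^sub>C real)) \<Rightarrow> bool" where
  "feller_semigroup Q \<longleftrightarrow>
     (\<forall>t\<ge>0. linear (Q t) \<and> (\<forall>f. norm (Q t f) \<le> norm f) \<and>
        (\<forall>f. (\<forall>x. 0 \<le> apply_bcontfun f x) \<longrightarrow> (\<forall>x. 0 \<le> apply_bcontfun (Q t f) x)) \<and>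
        Q t (const_bcontfun 1) = const_bcontfun 1) \<and>
     (\<forall>f. Q 0 f = f) \<and>
     (\<forall>s\<ge>0. \<forall>t\<ge>0. \<forall>f. Q (s + t) f = Q s (Q t f)) \<and>
     (\<forall>f. ((\<lambda>t. Q t f) \<longlongrightarrow> f) (at_right 0))"

definition natural_filtration ::
    "'v measure \<Rightarrow> (real \<Rightarrow> 'v \<Rightarrow> 'e::topological_space) \<Rightarrow> real \<Rightarrow> 'v measure" where
  "natural_filtration N F s =
     sigma (space N) {F u -` B \<inter> space N | u B. 0 \<le> u \<and> u \<le> s \<and> B \<in> sets borel}"

text \<open>A Markov process, with respect to its natural filtration, whose transition semigroup
  is Feller and whose sample paths are right-continuous with left limits.\<close>

definition feller_process :: "'v measure \<Rightarrow> (real \<Rightarrow> 'v \<Rightarrow> 'e::metric_space) \<Rightarrow> bool" where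
  "feller_process N F \<longleftrightarrow>
     prob_space N \<and>
     (\<forall>t\<ge>0. F t \<in> borel_measurable N) \<and>
     (\<forall>\<omega>\<in>space N. sample_path F \<omega> \<in> skorokhod_space) \<and>
     (\<exists>Q. feller_semigroup Q \<and>
        (\<forall>s\<ge>0. \<forall>t\<ge>0. \<forall>f :: 'e \<Rightarrow>\<^sub>C real. AE \<omega> in N.
           real_cond_exp N (natural_filtration N F s) (\<lambda>\<omega>. apply_bcontfun f (F (s + t) \<omega>)) \<omega>
             = apply_bcontfun (Q t f) (F s \<omega>)))"

end

theory Submission
  imports Defs
begin

text \<open>The weighted largest jump \<open>sup\<^sub>t e\<^sup>-\<^sup>t min 1 (dist (x (t-)) (x t))\<close> is a bounded continuous
  functional on the Skorokhod space, because a time change carries jumps to jumps and is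
  uniformly close to the identity on compact intervals.  It vanishes exactly on the continuous
  paths, and on the path of the \<open>n\<close>-th chain it is almost surely at most the largest
  \<open>\<rho>(\<iota> r, \<iota> s)\<close> with \<open>p\<^sub>n(r, s) > 0\<close>.  Hence its expectation along the chains tends to \<open>0\<close>, and
  weak convergence forces it to vanish almost surely on the limit.\<close>

section \<open>Jumps of cadlag paths\<close>

text \<open>The truncation is the one inside \<open>stopped_dist\<close>, so Skorokhod closeness
  bounds \<open>tdist\<close> directly, and it keeps the jump functional bounded.\<close>

definition tdist :: "'e::metric_space \<Rightarrow> 'e \<Rightarrow> real" where
  "tdist a b = min 1 (dist a b)"

lemma tdist_nonneg [simp]: "0 \<le> tdist a b"
  and tdist_le_1 [simp]: "tdist a b \<le> 1"
  and tdist_le_dist: "tdist a b \<le> dist a b"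
  and tdist_eq_0_iff: "tdist a b = 0 \<longleftrightarrow> a = b"
  by (auto simp: tdist_def min_def)

text \<open>If a term on the right is truncated, the right side is at least 1 and the left never
  exceeds 1; otherwise the triangle inequality applies, as truncation is 1-Lipschitz.\<close>

lemma tdist_quadrangle: "\<bar>tdist a b - tdist c d\<bar> \<le> tdist a c + tdist b d"
proof -
  have "dist a b \<le> dist a c + dist c d + dist b d" "dist c d \<le> dist a c + dist a b + dist b d"
    by metric+
  then show ?thesis
    using zero_le_dist[of a c] zero_le_dist[of b d] zero_le_dist[of a b] zero_le_dist[of c d]
    unfolding tdist_def by linarith
qed

lemma tendsto_tdist:
  "(f \<longlongrightarrow> a) G \<Longrightarrow> (g \<longlongrightarrow> b) G \<Longrightarrow> ((\<lambda>t. tdist (f t) (g t)) \<longlongrightarrow> tdist a b) G"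
  unfolding tdist_def by (intro tendsto_intros)

text \<open>For a cadlag path and \<open>t > 0\<close>, \<open>Lim\<close> is the true left limit.
  Elsewhere it may be arbitrary, but the truncation still keeps the value in [0, 1].\<close>

definition jump :: "(real \<Rightarrow> 'e::metric_space) \<Rightarrow> real \<Rightarrow> real" where
  "jump x t = tdist (Lim (at_left t) x) (x t)"

lemma jump_nonneg [simp]: "0 \<le> jump x t" and jump_le_1 [simp]: "jump x t \<le> 1"
  by (simp_all add: jump_def)

lemma jump_eq: "(x \<longlongrightarrow> l) (at_left t) \<Longrightarrow> jump x t = tdist l (x t)"
  unfolding jump_def by (simp add: tendsto_Lim)

text \<open>The weight discounts late jumps. Without it the supremum would be discontinuous: a unit
  jump at time \<open>n\<close> disappears in the Skorokhod limit as \<open>n\<close> grows.\<close>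

definition max_jump :: "(real \<Rightarrow> 'e::metric_space) \<Rightarrow> real" where
  "max_jump x = (SUP t\<in>{0<..}. exp (- t) * jump x t)"

lemma weighted_jump_le_1: "0 < t \<Longrightarrow> exp (- t) * jump x t \<le> 1"
  by (rule mult_le_one) auto

lemma weighted_jump_le_max_jump: "0 < t \<Longrightarrow> exp (- t) * jump x t \<le> max_jump x"
  unfolding max_jump_def
  by (rule cSUP_upper) (auto intro!: bdd_aboveI[of _ 1] weighted_jump_le_1)

lemma max_jump_leI: "(\<And>t. 0 < t \<Longrightarrow> exp (- t) * jump x t \<le> a) \<Longrightarrow> max_jump x \<le> a"
  unfolding max_jump_def by (rule cSUP_least) auto

lemma max_jump_nonneg: "0 \<le> max_jump x"
  using weighted_jump_le_max_jump[of 1 x] by (rule order_trans[rotated]) auto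

lemma max_jump_le_1: "max_jump x \<le> 1"
  by (rule max_jump_leI) (rule weighted_jump_le_1)

text \<open>A vanishing jump identifies the left limit with the value, and right-continuity is part
  of \<open>cadlag\<close>. At time 0 only the right side counts.\<close>

lemma continuous_on_if_max_jump_0:
  assumes "cadlag x" "max_jump x = 0"
  shows "continuous_on {0..} x"
proof (unfold continuous_on_eq_continuous_within, rule ballI)
  fix t :: real assume "t \<in> {0..}"
  then have right: "(x \<longlongrightarrow> x t) (at_right t)"
    using assms(1) by (simp add: cadlag_def)
  show "continuous (at t within {0..}) x"
  proof (cases "t = 0")
    case True
    then show ?thesis
      using right by (simp add: continuous_within at_within_Ici_at_right)
  next
    case False
    with \<open>t \<in> {0..}\<close> have t: "0 < t" by simp
    obtain l where l: "(x \<longlongrightarrow> l) (at_left t)"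
      using assms(1) t by (auto simp: cadlag_def)
    have "exp (- t) * jump x t \<le> 0"
      using weighted_jump_le_max_jump[OF t, of x] assms(2) by simp
    then have "jump x t = 0"
      by (simp add: mult_le_0_iff not_le order.antisym)
    then have "l = x t"
      by (simp add: jump_eq[OF l] tdist_eq_0_iff)
    with l right have "(x \<longlongrightarrow> x t) (at t)"
      by (simp add: filterlim_at_split)
    then show ?thesis
      by (simp add: continuous_within tendsto_within_subset[of x _ t UNIV])
  qed
qed

section \<open>Time changes\<close>

text \<open>\<open>time_gamma\<close> bounds the absolute logarithm of every slope of
  \<open>l\<close>, so all slopes lie between \<open>exp (- r)\<close> and
  \<open>exp r\<close>.\<close>

lemma time_change_increment:
  assumes l: "l \<in> time_changes" and r: "time_gamma l < ennreal r" and "0 \<le> t" "t < s"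
  shows "exp (- r) * (s - t) \<le> l s - l t" "l s - l t \<le> exp r * (s - t)"
proof -
  have mono: "l t < l s"
    using assms(1,3,4) by (auto simp: time_changes_def intro: strict_mono_onD)
  have "ennreal \<bar>ln ((l s - l t) / (s - t))\<bar> \<le> time_gamma l"
    unfolding time_gamma_def using assms by (intro SUP_upper2[of "(s, t)"]) auto
  then have "ennreal \<bar>ln ((l s - l t) / (s - t))\<bar> < ennreal r"
    using r by (rule order_le_less_trans)
  then have "\<bar>ln ((l s - l t) / (s - t))\<bar> < r"
    by (simp add: ennreal_less_iff)
  moreover have pos: "0 < (l s - l t) / (s - t)"
    using mono assms by simp
  ultimately have "exp (- r) < (l s - l t) / (s - t)" "(l s - l t) / (s - t) < exp r"
    by (metis abs_less_iff exp_less_mono exp_ln minus_less_iff)+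
  then show "exp (- r) * (s - t) \<le> l s - l t" "l s - l t \<le> exp r * (s - t)"
    using assms by (auto simp: field_simps)
qed

lemma time_change_less: "l \<in> time_changes \<Longrightarrow> 0 \<le> s \<Longrightarrow> s < t \<Longrightarrow> l s < l t"
  by (auto simp: time_changes_def intro: strict_mono_onD)

lemma time_change_0:
  assumes "l \<in> time_changes" shows "l 0 = 0"
proof -
  have im: "l ` {0..} = {0..}"
    using assms by (simp add: time_changes_def)
  obtain t where t: "0 \<le> t" "l t = 0"
    using im by (metis atLeast_iff image_iff order_refl)
  show ?thesis
  proof (cases "t = 0")
    case False
    then have "l 0 < l t" using t by (intro time_change_less[OF assms]) auto
    moreover have "0 \<le> l 0" using im by auto
    ultimately show ?thesis using t by simp
  qed (use t in simp)
qed

lemma time_change_pos: "l \<in> time_changes \<Longrightarrow> 0 < t \<Longrightarrow> 0 < l t"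
  using time_change_less[of l 0 t] time_change_0[of l] by simp

text \<open>The Lipschitz bound gives convergence and strict monotonicity keeps it strictly from
  below, so left limits at \<open>l t\<close> can be pulled back along \<open>l\<close>.\<close>

lemma time_change_tendsto_at_left:
  assumes l: "l \<in> time_changes" and r: "time_gamma l < ennreal r" and t: "0 < t"
  shows "filterlim l (at_left (l t)) (at_left t)"
proof -
  have ev: "eventually (\<lambda>s. 0 < s \<and> s < t) (at_left t)"
    using eventually_at_left_real[OF t] by simp
  have less: "eventually (\<lambda>s. l s < l t) (at_left t)"
    using ev by eventually_elim (simp add: time_change_less[OF l])
  have lower: "eventually (\<lambda>s. l t - exp r * (t - s) \<le> l s) (at_left t)"
    using ev
  proof eventually_elim
    case (elim s)
    then show ?case using time_change_increment(2)[OF l r, of s t] by simp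
  qed
  have upper: "eventually (\<lambda>s. l s \<le> l t) (at_left t)"
    using less by eventually_elim simp
  have "((\<lambda>s. l t - exp r * (t - s)) \<longlongrightarrow> l t - exp r * (t - t)) (at_left t)"
    by (intro tendsto_intros)
  then have "((\<lambda>s. l t - exp r * (t - s)) \<longlongrightarrow> l t) (at_left t)" by simp
  then have "(l \<longlongrightarrow> l t) (at_left t)"
    by (rule tendsto_sandwich[OF lower upper _ tendsto_const])
  then show ?thesis
    unfolding filterlim_at using less by (auto elim: eventually_mono)
qed

text \<open>Letting \<open>s\<close> increase to \<open>t\<close> in the closeness bound compares
  the two left limits; the bound at \<open>t\<close> itself compares the values. Each costs one
  \<open>\<eta>\<close>.\<close>

lemma jump_time_change:
  assumes l: "l \<in> time_changes" "time_gamma l < ennreal r"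
    and x: "cadlag x" and y: "cadlag y" and t: "0 < t"
    and close: "\<And>s. 0 < s \<Longrightarrow> s \<le> t \<Longrightarrow> tdist (x s) (y (l s)) \<le> \<eta>"
  shows "\<bar>jump x t - jump y (l t)\<bar> \<le> 2 * \<eta>"
proof -
  have "0 < l t" using l(1) t by (rule time_change_pos)
  then obtain b where b: "(y \<longlongrightarrow> b) (at_left (l t))"
    using y unfolding cadlag_def by blast
  obtain a where a: "(x \<longlongrightarrow> a) (at_left t)"
    using x t unfolding cadlag_def by blast
  have "((\<lambda>s. y (l s)) \<longlongrightarrow> b) (at_left t)"
    using b time_change_tendsto_at_left[OF l t] by (rule filterlim_compose)
  then have "((\<lambda>s. tdist (x s) (y (l s))) \<longlongrightarrow> tdist a b) (at_left t)"
    by (intro tendsto_tdist a)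
  moreover have "eventually (\<lambda>s. tdist (x s) (y (l s)) \<le> \<eta>) (at_left t)"
    using eventually_at_left_real[OF t] by eventually_elim (auto intro: close)
  ultimately have "tdist a b \<le> \<eta>"
    by (rule tendsto_upperbound) simp
  moreover have "tdist (x t) (y (l t)) \<le> \<eta>" using t by (intro close) auto
  ultimately show ?thesis
    unfolding jump_eq[OF a] jump_eq[OF b] using tdist_quadrangle[of a "x t" b "y (l t)"] by linarith
qed

section \<open>Continuity of the largest jump\<close>

lemma stopped_dist_upper: "0 \<le> t \<Longrightarrow> tdist (x (min t u)) (y (min (l t) u)) \<le> stopped_dist x y l u"
  unfolding stopped_dist_def tdist_def
  by (rule cSUP_upper) (auto intro!: bdd_aboveI[of _ 1])

text \<open>On the unit window from \<open>T\<close> to \<open>T + 1\<close> the weight is at least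
  \<open>exp (- (T + 1))\<close>. If \<open>stopped_dist\<close> exceeded
  \<open>r * exp (T + 1)\<close> throughout it, the integral would be at least \<open>r\<close>. At
  a good \<open>u \<ge> T\<close>, stopping does not affect times up to \<open>T\<close>.\<close>

lemma skorokhod_dist_lessD:
  assumes d: "skorokhod_dist x y < ennreal r" and r: "0 < r" and T: "0 \<le> T"
  obtains l where "l \<in> time_changes" "time_gamma l < ennreal r"
    "\<And>t. 0 \<le> t \<Longrightarrow> t \<le> T \<Longrightarrow> l t \<le> T \<Longrightarrow> tdist (x t) (y (l t)) \<le> r * exp (T + 1)"
proof -
  obtain l where l: "l \<in> time_changes" "time_gamma l < ennreal r"
    and int: "(\<integral>\<^sup>+u\<in>{0..}. ennreal (exp (- u) * stopped_dist x y l u) \<partial>lborel) < ennreal r"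
    using d unfolding skorokhod_dist_def by (auto simp: INF_less_iff)
  have "\<exists>u\<in>{T..T+1}. stopped_dist x y l u \<le> r * exp (T + 1)"
  proof (rule ccontr)
    assume "\<not> ?thesis"
    then have big: "r * exp (T + 1) < stopped_dist x y l u" if "u \<in> {T..T+1}" for u
      using that by (auto simp: not_le)
    have "r \<le> exp (- u) * stopped_dist x y l u" if u: "u \<in> {T..T+1}" for u
    proof -
      have "r = exp (- (T + 1)) * (r * exp (T + 1))"
        using exp_minus_inverse[of "T + 1"]
        by (simp add: mult.left_commute mult.commute del: minus_add_distrib)
      also have "\<dots> \<le> exp (- u) * stopped_dist x y l u"
        using big[OF u] u r by (intro mult_mono) auto
      finally show ?thesis .
    qed
    then have "(\<integral>\<^sup>+u. ennreal r * indicator {T..T+1} u \<partial>lborel)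
        \<le> (\<integral>\<^sup>+u\<in>{0..}. ennreal (exp (- u) * stopped_dist x y l u) \<partial>lborel)"
      using T by (intro nn_integral_mono) (auto simp: indicator_def intro!: ennreal_leI)
    moreover have "(\<integral>\<^sup>+u. ennreal r * indicator {T..T+1} u \<partial>lborel) = ennreal r"
      by (simp add: nn_integral_cmult_indicator)
    ultimately show False using int by simp
  qed
  then obtain u where u: "T \<le> u" "stopped_dist x y l u \<le> r * exp (T + 1)"
    by auto
  have "tdist (x t) (y (l t)) \<le> r * exp (T + 1)" if "0 \<le> t" "t \<le> T" "l t \<le> T" for t
  proof -
    have "min t u = t" "min (l t) u = l t" using that u by auto
    then show ?thesis using stopped_dist_upper[of t x u y l] that u by simp
  qed
  with l show ?thesis by (rule that)
qed

lemma exp_minus_diff_le: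
  fixes a b :: real
  assumes "0 \<le> a" "0 \<le> b"
  shows "\<bar>exp (- a) - exp (- b)\<bar> \<le> \<bar>a - b\<bar>"
proof -
  have *: "exp (- a) - exp (- b) \<le> b - a" if "0 \<le> a" "a \<le> b" for a b :: real
  proof -
    have "exp (- a) - exp (- b) = exp (- a) * (1 - exp (a - b))"
      by (simp add: algebra_simps flip: exp_add)
    also have "\<dots> \<le> 1 - exp (a - b)"
      using that by (intro mult_left_le_one_le) auto
    also have "\<dots> \<le> b - a" using exp_ge_add_one_self[of "a - b"] by linarith
    finally show ?thesis .
  qed
  show ?thesis
  proof (cases "a \<le> b")
    case True
    then have "exp (- b) \<le> exp (- a)" by simp
    then show ?thesis using *[of a b] True assms by simp
  next
    case False
    then have "exp (- a) \<le> exp (- b)" by simp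
    then show ?thesis using *[of b a] False assms by simp
  qed
qed

text \<open>Up to time \<open>T\<close>, jumps of the two paths are paired through \<open>l\<close>,
  with an error from the jump sizes and one from the shifted weights; later jumps weigh at most
  \<open>exp (- T)\<close>.\<close>

lemma max_jump_diff:
  assumes x: "cadlag x" and y: "cadlag y" and r: "0 < r" and T: "0 \<le> T"
    and d: "skorokhod_dist x y < ennreal r"
    and rT: "(exp r - 1) * (T + 1) \<le> 1"
    and e: "exp (- T) \<le> e" "2 * (r * exp (T + 2)) + (exp r - 1) * (T + 1) \<le> e"
  shows "\<bar>max_jump x - max_jump y\<bar> \<le> e"
proof -
  \<comment> \<open>The paths are compared up to \<open>T + 1\<close>, because \<open>l\<close> and
    its inverse may move a time below \<open>T\<close> beyond \<open>T\<close>; this raises the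
    exponent to \<open>T + 2\<close>.\<close>
  define \<eta> where "\<eta> = r * exp (T + 2)"
  obtain l where l: "l \<in> time_changes" "time_gamma l < ennreal r"
    and close: "\<And>t. 0 \<le> t \<Longrightarrow> t \<le> T + 1 \<Longrightarrow> l t \<le> T + 1 \<Longrightarrow> tdist (x t) (y (l t)) \<le> \<eta>"
    using skorokhod_dist_lessD[OF d r, of "T + 1"] T unfolding \<eta>_def by (auto simp: add.assoc)
  have inc: "exp (- r) * t \<le> l t" "l t \<le> exp r * t" if "0 < t" for t
    using time_change_increment[OF l, of 0 t] time_change_0[OF l(1)] that by auto
  have inc': "t \<le> exp r * l t" if "0 < t" for t
    using inc(1)[OF that] by (simp add: exp_minus field_simps)
  have er: "1 \<le> exp r" using r by simp
  \<comment> \<open>By \<open>rT\<close>, dilation by \<open>exp r\<close> moves times up to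
    \<open>T\<close> by at most 1. This serves both for \<open>l t\<close> and for the preimage of a
    jump time of \<open>y\<close>.\<close>
  have stretch: "exp r * t \<le> T + 1" if "0 \<le> t" "t \<le> T" for t
  proof -
    have "(exp r - 1) * t \<le> (exp r - 1) * (T + 1)"
      using that er by (intro mult_left_mono) auto
    then show ?thesis using rT that by (simp add: algebra_simps)
  qed
  have main: "\<bar>exp (- t) * jump x t - exp (- l t) * jump y (l t)\<bar> \<le> e"
    if t: "0 < t" "t \<le> T + 1" "l t \<le> T + 1" for t
  proof -
    have lt: "0 < l t" using l(1) t(1) by (rule time_change_pos)
    have "tdist (x s) (y (l s)) \<le> \<eta>" if s: "0 < s" "s \<le> t" for s
    proof (rule close)
      have "l s \<le> l t"
        using time_change_less[OF l(1), of s t] s by (cases "s = t") auto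
      then show "l s \<le> T + 1" using t by simp
    qed (use s t in auto)
    then have J: "\<bar>jump x t - jump y (l t)\<bar> \<le> 2 * \<eta>"
      by (rule jump_time_change[OF l x y t(1)])
    \<comment> \<open>\<open>inc\<close> gives \<open>l t - t \<le> (exp r - 1) * t\<close>, and
      \<open>inc'\<close> gives \<open>t - l t \<le> (exp r - 1) * l t\<close>; both times are at
      most \<open>T + 1\<close>.\<close>
    have "(exp r - 1) * t \<le> (exp r - 1) * (T + 1)" "(exp r - 1) * l t \<le> (exp r - 1) * (T + 1)"
      using t er by (auto intro!: mult_left_mono)
    then have "\<bar>t - l t\<bar> \<le> (exp r - 1) * (T + 1)"
      using inc(2)[OF t(1)] inc'[OF t(1)] by (simp add: algebra_simps abs_le_iff)
    then have E: "\<bar>exp (- t) - exp (- l t)\<bar> \<le> (exp r - 1) * (T + 1)"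
      using exp_minus_diff_le[of t "l t"] t lt by linarith
    have "exp (- t) * jump x t - exp (- l t) * jump y (l t)
        = exp (- t) * (jump x t - jump y (l t)) + (exp (- t) - exp (- l t)) * jump y (l t)"
      by (simp add: algebra_simps)
    also have "\<bar>\<dots>\<bar> \<le> exp (- t) * \<bar>jump x t - jump y (l t)\<bar> + \<bar>exp (- t) - exp (- l t)\<bar> * jump y (l t)"
      by (rule order_trans[OF abs_triangle_ineq]) (simp add: abs_mult)
    also have "\<dots> \<le> \<bar>jump x t - jump y (l t)\<bar> + \<bar>exp (- t) - exp (- l t)\<bar>"
      using t by (intro add_mono mult_left_le_one_le mult_right_le_one_le) auto
    finally show ?thesis using J E e(2) unfolding \<eta>_def by linarith
  qed
  have late: "exp (- t) * jump z t \<le> e" if "T \<le> t" for t and z :: "real \<Rightarrow> 'a"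
  proof -
    have "exp (- t) * jump z t \<le> exp (- T) * 1" using that by (intro mult_mono) auto
    then show ?thesis using e(1) by simp
  qed
  have "max_jump x \<le> max_jump y + e"
  proof (rule max_jump_leI)
    fix t :: real assume t: "0 < t"
    show "exp (- t) * jump x t \<le> max_jump y + e"
    proof (cases "t \<le> T")
      case True
      have lt: "0 < l t" using l(1) t by (rule time_change_pos)
      have "l t \<le> T + 1" using inc(2)[OF t] stretch[of t] t True by simp
      then show ?thesis using main[OF t] True weighted_jump_le_max_jump[OF lt, of y] by linarith
    next
      case False
      then show ?thesis using late[of t x] max_jump_nonneg[of y] by simp
    qed
  qed
  moreover have "max_jump y \<le> max_jump x + e"
  proof (rule max_jump_leI)
    fix s :: real assume s: "0 < s"
    show "exp (- s) * jump y s \<le> max_jump x + e"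
    proof (cases "s \<le> T")
      case True
      \<comment> \<open>Surjectivity of \<open>l\<close> lets every jump time of \<open>y\<close> be
        matched with a time of \<open>x\<close>, giving the reverse inequality from the same
        estimate.\<close>
      have "s \<in> l ` {0..}" using l(1) s by (simp add: time_changes_def)
      then obtain t where "0 \<le> t" "s = l t" by auto
      then have t: "0 < t" "s = l t" using s time_change_0[OF l(1)] by (cases "t = 0"; simp)+
      have "t \<le> T + 1" using inc'[OF t(1)] stretch[of s] s True t(2) by simp
      then show ?thesis using main[OF t(1)] True weighted_jump_le_max_jump[OF t(1), of x] t(2) by simp
    next
      case False
      then show ?thesis using late[of s y] max_jump_nonneg[of x] by simp
    qed
  qed
  ultimately show ?thesis by linarith
qed

lemma max_jump_continuous_at:
  fixes x :: "real \<Rightarrow> 'e::metric_space"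
  assumes x: "cadlag x" and e: "0 < e"
  obtains r where "0 < r"
    "\<And>y. cadlag y \<Longrightarrow> skorokhod_dist x y < ennreal r \<Longrightarrow> \<bar>max_jump x - max_jump y\<bar> < e"
proof -
  \<comment> \<open>Halving leaves room for a strict inequality; the cap at 1 makes
    \<open>T = - ln e'\<close> nonnegative and later yields the dilation condition on
    \<open>r\<close>.\<close>
  define e' where "e' = min (e / 2) 1"
  have e': "0 < e'" "e' < e" "e' \<le> 1" using e by (auto simp: e'_def)
  define T where "T = - ln e'"
  have T: "0 \<le> T" "exp (- T) \<le> e'" using e' by (auto simp: T_def)
  \<comment> \<open>With \<open>T\<close> fixed by the tail, the remaining error vanishes as
    \<open>r\<close> tends to 0 from the right, so a suitable positive \<open>r\<close>
    exists.\<close>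
  have "((\<lambda>r. 2 * (r * exp (T + 2)) + (exp r - 1) * (T + 1)) \<longlongrightarrow>
      2 * (0 * exp (T + 2)) + (exp 0 - 1) * (T + 1)) (at_right 0)"
    by (intro tendsto_intros)
  then have "eventually (\<lambda>r. 2 * (r * exp (T + 2)) + (exp r - 1) * (T + 1) < e') (at_right 0)"
    using e' by (intro order_tendstoD(2)) auto
  then have "eventually (\<lambda>r. 0 < r \<and> 2 * (r * exp (T + 2)) + (exp r - 1) * (T + 1) < e') (at_right 0)"
    by (intro eventually_conj eventually_at_right_less)
  then obtain r where r: "0 < r" "2 * (r * exp (T + 2)) + (exp r - 1) * (T + 1) < e'"
    by (auto dest!: eventually_happens)
  have "0 < 2 * (r * exp (T + 2))" using r by simp
  then have "(exp r - 1) * (T + 1) \<le> 1" using r e' by linarith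
  then have "\<bar>max_jump x - max_jump y\<bar> < e" if "cadlag y" "skorokhod_dist x y < ennreal r" for y
    using max_jump_diff[OF x that(1) r(1) T(1) that(2) _ T(2)] r(2) e' by linarith
  with r(1) show ?thesis by (rule that)
qed

lemma continuous_map_max_jump:
  "continuous_map skorokhod_topology euclideanreal (max_jump :: (real \<Rightarrow> 'e::metric_space) \<Rightarrow> real)"
  unfolding continuous_map_def
proof (intro conjI allI impI)
  fix U :: "real set" assume "openin euclideanreal U"
  then have U: "open U" by simp
  show "openin skorokhod_topology {x :: real \<Rightarrow> 'e. x \<in> topspace skorokhod_topology \<and> max_jump x \<in> U}"
    unfolding openin_skorokhod_topology topspace_skorokhod_topology
  proof (intro conjI ballI)
    fix x :: "real \<Rightarrow> 'e" assume "x \<in> {x \<in> skorokhod_space. max_jump x \<in> U}"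
    then have x: "cadlag x" "max_jump x \<in> U" by (auto simp: skorokhod_space_def)
    obtain e where e: "0 < e" "\<And>b. dist b (max_jump x) < e \<Longrightarrow> b \<in> U"
      using U x(2) unfolding open_dist by blast
    obtain r where "0 < r"
      "\<And>y. cadlag y \<Longrightarrow> skorokhod_dist x y < ennreal r \<Longrightarrow> \<bar>max_jump x - max_jump y\<bar> < e"
      using max_jump_continuous_at[OF x(1) e(1)] by blast
    then show "\<exists>r>0. \<forall>y\<in>skorokhod_space. skorokhod_dist x y < r \<longrightarrow>
        y \<in> {x \<in> skorokhod_space. max_jump x \<in> U}"
      by (intro exI[of _ "ennreal r"])
        (auto simp: skorokhod_space_def dist_real_def abs_minus_commute intro!: e(2))
  qed auto
qed auto

section \<open>Borel measurability of continuous maps\<close>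

lemma space_borel_of: "space (borel_of T) = topspace T"
  unfolding borel_of_def by (rule space_measure_of) (auto dest: openin_subset)

lemma continuous_map_measurable_borel_of:
  assumes "continuous_map T euclidean f"
  shows "f \<in> borel_measurable (borel_of T)"
proof (rule borel_measurableI)
  fix U :: "'b set" assume "open U"
  then have "openin T {x \<in> topspace T. f x \<in> U}"
    using assms by (simp add: openin_continuous_map_preimage)
  moreover have "f -` U \<inter> space (borel_of T) = {x \<in> topspace T. f x \<in> U}"
    by (auto simp: space_borel_of)
  ultimately show "f -` U \<inter> space (borel_of T) \<in> sets (borel_of T)"
    unfolding borel_of_def by (auto dest: openin_subset)
qed

section \<open>Markov chains only make transitions of positive probability\<close>

text \<open>\<open>markov_chain\<close> prescribes probabilities given the whole history. Over a
  finite state space there are finitely many histories up to time \<open>k\<close>, so the forbidden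
  continuations form a finite union of null events.\<close>

lemma markov_chain_transition_pos:
  assumes mc: "markov_chain M Z q X" and fin: "finite Z"
  shows "AE \<omega> in M. \<forall>k. 0 < q (X k \<omega>) (X (Suc k) \<omega>)"
proof (unfold AE_all_countable, rule allI)
  fix k :: nat
  interpret prob_space M using mc by (simp add: markov_chain_def)
  have X [measurable]: "X i \<in> measurable M (count_space Z)" for i
    using mc by (simp add: markov_chain_def)
  have XZ: "X i \<omega> \<in> Z" if "\<omega> \<in> space M" for i \<omega>
    using measurable_space[OF X that] by simp
  \<comment> \<open>Histories are taken in \<open>PiE\<close>, fixed outside \<open>{..k}\<close>,
    which makes \<open>H\<close> finite.\<close>
  define H where "H = {(h, y). h \<in> PiE {..k} (\<lambda>_. Z) \<and> y \<in> Z \<and> q (h k) y = 0}"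
  have "H \<subseteq> PiE {..k} (\<lambda>_. Z) \<times> Z"
    by (auto simp: H_def)
  then have "finite H"
    by (rule finite_subset) (intro finite_cartesian_product finite_PiE fin finite_atMost)
  have *: "AE \<omega> in M. \<not> (X (Suc k) \<omega> = y \<and> (\<forall>i\<le>k. X i \<omega> = h i))" if hy: "(h, y) \<in> H" for h y
  proof -
    have y: "y \<in> Z" "q (h k) y = 0" using hy by (auto simp: H_def)
    have h: "h i \<in> Z" if "i \<le> k" for i using hy that by (auto simp: H_def)
    have ev: "{\<omega> \<in> space M. X i \<omega> = z} \<in> events" if "z \<in> Z" for i z
      using measurable_sets[OF X, of "{z}" i] that by (auto simp: vimage_def Int_def conj_commute)
    have "{\<omega> \<in> space M. \<forall>i\<in>{..k}. X i \<omega> = h i} \<in> events"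
      by (rule sets.sets_Collect_finite_All) (auto intro!: ev h)
    then have B: "{\<omega> \<in> space M. \<forall>i\<le>k. X i \<omega> = h i} \<in> events" by (simp add: Ball_def)
    have AB: "{\<omega> \<in> space M. X (Suc k) \<omega> = y \<and> (\<forall>i\<le>k. X i \<omega> = h i)} \<in> events"
      using ev[OF y(1), of "Suc k"] B by (intro sets.sets_Collect_conj)
    have "prob {\<omega> \<in> space M. X (Suc k) \<omega> = y \<and> (\<forall>i\<le>k. X i \<omega> = h i)} = 0"
    \<comment> \<open>A history of positive probability has conditional probability
      \<open>q (h k) y = 0\<close> of continuing to \<open>y\<close>; any other history is itself
      null.\<close>
    proof (cases "prob {\<omega> \<in> space M. \<forall>i\<le>k. X i \<omega> = h i} > 0")
      case True
      then have "\<P>(\<omega> in M. X (Suc k) \<omega> = y \<bar> \<forall>i\<le>k. X i \<omega> = h i) = 0"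
        using mc y by (simp add: markov_chain_def)
      then show ?thesis using True by (simp add: cond_prob_def)
    next
      case False
      have "prob {\<omega> \<in> space M. X (Suc k) \<omega> = y \<and> (\<forall>i\<le>k. X i \<omega> = h i)}
          \<le> prob {\<omega> \<in> space M. \<forall>i\<le>k. X i \<omega> = h i}"
        using B by (intro finite_measure_mono) auto
      then show ?thesis using False by (simp add: measure_le_0_iff not_less)
    qed
    then show ?thesis
      using AB by (subst AE_iff_measurable[OF AB]) (auto simp: emeasure_eq_measure)
  qed
  have "AE \<omega> in M. \<forall>z\<in>H. case z of (h, y) \<Rightarrow> \<not> (X (Suc k) \<omega> = y \<and> (\<forall>i\<le>k. X i \<omega> = h i))"
    using \<open>finite H\<close> * by (intro AE_finite_allI) auto
  then show "AE \<omega> in M. 0 < q (X k \<omega>) (X (Suc k) \<omega>)"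
  proof (rule AE_mp, intro AE_I2 impI)
    fix \<omega> assume \<omega>: "\<omega> \<in> space M"
      and avoid: "\<forall>z\<in>H. case z of (h, y) \<Rightarrow> \<not> (X (Suc k) \<omega> = y \<and> (\<forall>i\<le>k. X i \<omega> = h i))"
    \<comment> \<open>The realized history lies in the product space, so avoiding \<open>H\<close>
      can only mean that the transition entry is nonzero.\<close>
    have "(restrict (\<lambda>i. X i \<omega>) {..k}, X (Suc k) \<omega>) \<notin> H"
      using avoid by fastforce
    then have "q (X k \<omega>) (X (Suc k) \<omega>) \<noteq> 0"
      using XZ[OF \<omega>] by (auto simp: H_def)
    moreover have "0 \<le> q (X k \<omega>) (X (Suc k) \<omega>)"
      using mc XZ[OF \<omega>] by (auto simp: markov_chain_def stochastic_matrix_def)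
    ultimately show "0 < q (X k \<omega>) (X (Suc k) \<omega>)" by simp
  qed
qed

section \<open>Jumps of step paths\<close>

text \<open>Just to the left of an integer the floor is one less; near any other point it is locally
  constant.\<close>

lemma floor_at_left:
  fixes a :: real
  obtains j :: int where "j = \<lfloor>a\<rfloor> \<or> j = \<lfloor>a\<rfloor> - 1" "eventually (\<lambda>b. \<lfloor>b\<rfloor> = j) (at_left a)"
proof (cases "a \<in> \<int>")
  case True
  then have "real_of_int \<lfloor>a\<rfloor> = a" by (auto elim: Ints_cases)
  moreover have "eventually (\<lambda>b. b \<in> {a - 1<..<a}) (at_left a)"
    by (rule eventually_at_left_real) simp
  ultimately have "eventually (\<lambda>b. \<lfloor>b\<rfloor> = \<lfloor>a\<rfloor> - 1) (at_left a)"
    by (auto elim!: eventually_mono simp: floor_eq_iff)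
  then show ?thesis by (intro that[of "\<lfloor>a\<rfloor> - 1"]) auto
next
  case False
  then have "real_of_int \<lfloor>a\<rfloor> < a"
    by (metis Ints_of_int less_eq_real_def of_int_floor_le)
  then have "eventually (\<lambda>b. b \<in> {real_of_int \<lfloor>a\<rfloor><..<a}) (at_left a)"
    by (rule eventually_at_left_real)
  then have "eventually (\<lambda>b. \<lfloor>b\<rfloor> = \<lfloor>a\<rfloor>) (at_left a)"
  proof eventually_elim
    case (elim b)
    moreover have "a < real_of_int \<lfloor>a\<rfloor> + 1" by linarith
    ultimately show ?case unfolding floor_eq_iff greaterThanLessThan_iff by linarith
  qed
  then show ?thesis by (intro that[of "\<lfloor>a\<rfloor>"]) auto
qed

text \<open>The left limit and the value at any time are terms of \<open>g\<close> with equal or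
  consecutive indices.\<close>

lemma max_jump_step_path:
  assumes h: "0 < h" and \<delta>: "\<And>k. dist (g k) (g (Suc k)) \<le> \<delta>"
  shows "max_jump (\<lambda>t\<in>{0..}. g (nat \<lfloor>t / h\<rfloor>)) \<le> \<delta>"
proof (rule max_jump_leI)
  fix t :: real assume t: "0 < t"
  let ?x = "\<lambda>t\<in>{0..}. g (nat \<lfloor>t / h\<rfloor>)"
  obtain j where j: "j = \<lfloor>t / h\<rfloor> \<or> j = \<lfloor>t / h\<rfloor> - 1" "eventually (\<lambda>b. \<lfloor>b\<rfloor> = j) (at_left (t / h))"
    by (rule floor_at_left)
  have "filterlim (\<lambda>s. s / h) (at_left (t / h)) (at_left t)"
    unfolding filterlim_at
    using h by (auto intro!: tendsto_intros simp: eventually_at_filter divide_strict_right_mono)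
  then have "eventually (\<lambda>s. \<lfloor>s / h\<rfloor> = j) (at_left t)"
    using j(2) by (rule eventually_compose_filterlim[rotated])
  moreover have "eventually (\<lambda>s. 0 < s) (at_left t)"
    using eventually_at_left_real[OF t] by eventually_elim simp
  ultimately have "eventually (\<lambda>s. ?x s = g (nat j)) (at_left t)"
    by eventually_elim auto
  then have "(?x \<longlongrightarrow> g (nat j)) (at_left t)"
    by (rule tendsto_eventually)
  then have "jump ?x t = tdist (g (nat j)) (g (nat \<lfloor>t / h\<rfloor>))"
    using t by (simp add: jump_eq)
  also have "\<dots> \<le> dist (g (nat j)) (g (nat \<lfloor>t / h\<rfloor>))"
    by (rule tdist_le_dist)
  also have "\<dots> \<le> \<delta>"
  \<comment> \<open>Comparing after \<open>nat\<close> also covers \<open>j = -1\<close>, which the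
    disjunction on \<open>j\<close> allows when the floor is 0. Equal indices use
    \<open>0 \<le> \<delta>\<close>, since \<open>\<delta>\<close> bounds a distance.\<close>
  proof (cases "nat j = nat \<lfloor>t / h\<rfloor>")
    case True
    then show ?thesis using order_trans[OF zero_le_dist \<delta>] by simp
  next
    case False
    then have "nat \<lfloor>t / h\<rfloor> = Suc (nat j)" using j(1) by linarith
    then show ?thesis using \<delta> by simp
  qed
  finally have "jump ?x t \<le> \<delta>" .
  moreover have "exp (- t) * jump ?x t \<le> 1 * jump ?x t"
    using t by (intro mult_right_mono) auto
  ultimately show "exp (- t) * jump ?x t \<le> \<delta>" by simp
qed

theorem proposition4p6:
  fixes S :: "nat \<Rightarrow> 's set" and root :: 's
    and p :: "nat \<Rightarrow> 's \<Rightarrow> 's \<Rightarrow> real" and c :: "nat \<Rightarrow> real"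
    and D :: "nat \<Rightarrow> ('s \<Rightarrow> real) \<Rightarrow> ('s \<Rightarrow> real)"
    and M :: "nat \<Rightarrow> 'w measure" and X :: "nat \<Rightarrow> nat \<Rightarrow> 'w \<Rightarrow> 's"
    and \<iota> :: "'s \<Rightarrow> 'e::metric_space" and dlim :: "'s \<Rightarrow> ('e \<Rightarrow>\<^sub>C real)"
    and \<epsilon> :: "nat \<Rightarrow> real" and \<mu> :: "'e measure"
    and N :: "'v measure" and F :: "real \<Rightarrow> 'v \<Rightarrow> 'e"
  assumes A0: "\<And>n. finite (S n)" "disjoint_family S" "S 0 = {root}"
    and chains: "\<And>n. markov_chain (M n) (S n) (p n) (X n)"
    and A1: "\<And>n. 0 < c n \<and> c n < c (Suc n)"
    and A2: "\<And>n. transition_operator (S n) (S (Suc n)) (D (Suc n))"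
    and A3: "\<And>n. (\<lambda>f x. gen_A S p c (Suc n) f x + c n * f x) ` CZ (S (Suc n))
                  \<subseteq> D (Suc n) ` CZ (S n)"
    and A4: "\<And>n. inj_on (D (Suc n)) (CZ (S n))"
    and A5: "\<And>n f. f \<in> CZ (S n) \<Longrightarrow>
                gen_A S p c (Suc n) (D (Suc n) f) = D (Suc n) (gen_A S p c n f)"
    and E_compact: "compact (UNIV :: 'e set)"
    and L1: "\<And>x. \<exists>s. (\<forall>n. s n \<in> S n) \<and> (\<lambda>n. \<iota> (s n)) \<longlonglongrightarrow> x"
    and L2: "closure (span (dlim ` (\<Union>n. S n))) = UNIV"
    and L3: "\<And>s. s \<in> (\<Union>n. S n) \<Longrightarrow>
                (\<lambda>n. SUP u\<in>S n. \<bar>dens S D s u - apply_bcontfun (dlim s) (\<iota> u)\<bar>) \<longlonglongrightarrow> 0"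
    and c_lim: "filterlim c at_top sequentially"
    and eps: "\<And>n. 0 < \<epsilon> n" "(\<lambda>n. \<epsilon> n * c n) \<longlonglongrightarrow> 1"
    and init: "weakly_converges euclidean (\<lambda>n. distr (M n) borel (\<lambda>\<omega>. \<iota> (X n 0 \<omega>))) \<mu>"
    and F_feller: "feller_process N F"
    and F_init: "distr N borel (F 0) = \<mu>"
    and F_limit: "converges_in_distribution skorokhod_topology M
                    (\<lambda>n. sample_path (\<lambda>t \<omega>. \<iota> (X n (nat \<lfloor>t / \<epsilon> n\<rfloor>) \<omega>))) N (sample_path F)"
    and small_jumps:
      "(\<lambda>n. SUP (r, s)\<in>{(r, s). r \<in> S n \<and> s \<in> S n \<and> p n r s > 0}. dist (\<iota> r) (\<iota> s))
         \<longlonglongrightarrow> 0"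
  shows "AE \<omega> in N. continuous_on {0..} (\<lambda>t. F t \<omega>)"
proof -
  interpret N: prob_space N using F_feller by (simp add: feller_process_def)
  let ?B = "borel_of (skorokhod_topology :: (real \<Rightarrow> 'e) topology)"
  define Y where "Y n = sample_path (\<lambda>t \<omega>. \<iota> (X n (nat \<lfloor>t / \<epsilon> n\<rfloor>) \<omega>))" for n
  define \<delta> where "\<delta> n = (SUP (r, s)\<in>{(r, s). r \<in> S n \<and> s \<in> S n \<and> p n r s > 0}. dist (\<iota> r) (\<iota> s))" for n
  have Y [measurable]: "Y n \<in> measurable (M n) ?B" for n
    using F_limit unfolding converges_in_distribution_def Y_def by auto
  have F [measurable]: "sample_path F \<in> measurable N ?B"
    and weak: "weakly_converges skorokhod_topology (\<lambda>n. distr (M n) ?B (Y n)) (distr N ?B (sample_path F))"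
    using F_limit unfolding converges_in_distribution_def Y_def by auto
  have J [measurable]: "max_jump \<in> borel_measurable ?B"
    by (rule continuous_map_measurable_borel_of[OF continuous_map_max_jump])
  have "bounded (max_jump ` topspace (skorokhod_topology :: (real \<Rightarrow> 'e) topology))"
    by (rule boundedI[of _ 1]) (auto simp: max_jump_nonneg max_jump_le_1)
  then have "(\<lambda>n. LINT x|distr (M n) ?B (Y n). max_jump x) \<longlonglongrightarrow>
      (LINT x|distr N ?B (sample_path F). max_jump x)"
    using weak continuous_map_max_jump unfolding weakly_converges_def by blast
  then have lim: "(\<lambda>n. LINT \<omega>|M n. max_jump (Y n \<omega>)) \<longlonglongrightarrow> (LINT \<omega>|N. max_jump (sample_path F \<omega>))"
    by (simp add: integral_distr)
  have "(LINT \<omega>|M n. max_jump (Y n \<omega>)) \<le> \<delta> n" for n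
  proof -
    interpret Mn: prob_space "M n" using chains[of n] by (simp add: markov_chain_def)
    \<comment> \<open>Finiteness of \<open>S n\<close> makes the real supremum
      \<open>\<delta> n\<close> a genuine upper bound for the individual distances.\<close>
    have bdd: "bdd_above ((\<lambda>(r, s). dist (\<iota> r) (\<iota> s)) ` {(r, s). r \<in> S n \<and> s \<in> S n \<and> p n r s > 0})"
      by (rule bdd_above_finite, rule finite_imageI, rule finite_subset[of _ "S n \<times> S n"])
        (auto simp: A0(1))
    have "AE \<omega> in M n. max_jump (Y n \<omega>) \<le> \<delta> n"
      using markov_chain_transition_pos[OF chains A0(1)]
    proof (rule AE_mp, intro AE_I2 impI)
      fix \<omega> assume \<omega>: "\<omega> \<in> space (M n)" and pos: "\<forall>k. 0 < p n (X n k \<omega>) (X n (Suc k) \<omega>)"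
      have "X n k \<in> measurable (M n) (count_space (S n))" for k
        using chains[of n] by (simp add: markov_chain_def)
      from measurable_space[OF this \<omega>] have XS: "X n k \<omega> \<in> S n" for k by simp
      have "dist (\<iota> (X n k \<omega>)) (\<iota> (X n (Suc k) \<omega>)) \<le> \<delta> n" for k
        unfolding \<delta>_def using pos XS
        by (intro cSUP_upper2[OF bdd, of "(X n k \<omega>, X n (Suc k) \<omega>)"]) auto
      then show "max_jump (Y n \<omega>) \<le> \<delta> n"
        unfolding Y_def sample_path_def by (rule max_jump_step_path[OF eps(1)])
    qed
    moreover have "integrable (M n) (\<lambda>\<omega>. max_jump (Y n \<omega>))"
      by (rule Mn.integrable_const_bound[of _ 1]) (auto simp: max_jump_nonneg max_jump_le_1)
    ultimately show ?thesis by (rule Mn.integral_le_const[rotated])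
  qed
  \<comment> \<open>The integrals along the chains converge to the one on the limit and are
    dominated by \<open>\<delta> n\<close>, which tends to 0. A nonnegative integrable function with
    integral 0 vanishes almost everywhere.\<close>
  then have "(LINT \<omega>|N. max_jump (sample_path F \<omega>)) \<le> 0"
    using lim small_jumps unfolding \<delta>_def by (intro LIMSEQ_le) auto
  moreover have "0 \<le> (LINT \<omega>|N. max_jump (sample_path F \<omega>))"
    by (intro integral_nonneg_AE AE_I2 max_jump_nonneg)
  moreover have "integrable N (\<lambda>\<omega>. max_jump (sample_path F \<omega>))"
    by (rule N.integrable_const_bound[of _ 1]) (auto simp: max_jump_nonneg max_jump_le_1)
  ultimately have "AE \<omega> in N. max_jump (sample_path F \<omega>) = 0"
    using integral_nonneg_eq_0_iff_AE[of N "\<lambda>\<omega>. max_jump (sample_path F \<omega>)"]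
    by (simp add: max_jump_nonneg)
  then show ?thesis
  proof (rule AE_mp, intro AE_I2 impI)
    fix \<omega> assume \<omega>: "\<omega> \<in> space N" and 0: "max_jump (sample_path F \<omega>) = 0"
    have "cadlag (sample_path F \<omega>)"
      using F_feller \<omega> by (simp add: feller_process_def skorokhod_space_def)
    then have "continuous_on {0..} (sample_path F \<omega>)"
      using 0 by (rule continuous_on_if_max_jump_0)
    \<comment> \<open>\<open>sample_path\<close> only restricts to \<open>{0..}\<close>, where it
      agrees with \<open>F\<close>.\<close>
    then show "continuous_on {0..} (\<lambda>t. F t \<omega>)"
      by (rule continuous_on_eq) (simp add: sample_path_def)
  qed
qed

end
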